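(* Let $d\ge 1$ be an integer. The polynomial $E_d(q)$ has exactly $d+1$ roots in the closed interval $[0,1]$, including roots at the endpoints $q=0$ and $q=1$. Moreover, the roots of $E_d$ in the open interval $(0,1)$ interleave the roots of $E_{d+1}$ in that interval; that is, if $a_1<\dots<a_{d-1}$ are the roots of $E_d$ in $(0,1)$ and $b_1<\dots<b_d$ are the roots of $E_{d+1}$ in $(0,1)$, then $b_i<a_i<b_{i+1}$ for all $i=1,\dots,d-1$.
   Context: For an integer $d\ge 1$, $E_d(q)$ is the real polynomial $$E_d(q)=\sum_{i=0}^{d}(-1)^{i+1}\binom{d}{i}q^{2^{d-i}}.$$ (It is the expected Euler characteristic per unit volume of the $d$-dimensional voxel model of random cubical complexes, in which each $d$-cube is excluded with probability $q$.) *)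

theory Defs
  imports "HOL-Computational_Algebra.Polynomial"
begin

definition E :: "nat \<Rightarrow> real poly" where
  "E d = (\<Sum>i=0..d. monom ((-1) ^ (i + 1) * real (d choose i)) (2 ^ (d - i)))"

end

theory Submission
  imports Defs
begin

text \<open>
  Pascal's rule gives \<open>E\<^sub>d\<^sub>+\<^sub>1(q) = E\<^sub>d(q\<^sup>2) - E\<^sub>d(q)\<close>. The induction on \<open>d\<close> carries along, besides the
  alternation of signs, the separation property that consecutive roots \<open>r < s\<close> of \<open>E\<^sub>d\<close> satisfy
  \<open>r < s\<^sup>2\<close>. If \<open>r < s\<close> are consecutive roots, then \<open>E\<^sub>d\<^sub>+\<^sub>1(\<surd>r) = - E\<^sub>d(\<surd>r)\<close> and
  \<open>E\<^sub>d\<^sub>+\<^sub>1(s) = E\<^sub>d(s\<^sup>2)\<close>, and both \<open>\<surd>r\<close> and \<open>s\<^sup>2\<close> lie between \<open>r\<close> and \<open>s\<close>, so \<open>E\<^sub>d\<^sub>+\<^sub>1\<close> changes sign on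
  \<open>(\<surd>r, s)\<close> (at the ends 0 and 1 the derivatives give the signs). Roots found in these intervals
  interlace with those of \<open>E\<^sub>d\<close> and are again separated. There are no others, because \<open>E\<^sub>d\<^sub>+\<^sub>1\<close> has
  only \<open>d + 2\<close> nonzero coefficients, hence at most \<open>d + 1\<close> positive roots.
\<close>

section \<open>Counting positive roots by nonzero coefficients\<close>

text \<open>Every element of \<open>S\<close> except the maximum is sent to a point of
  \<open>T\<close> between it and its successor in \<open>S\<close>. The gaps are disjoint, so this
  map is injective.\<close>

lemma card_le_Suc_card_separating:
  fixes S T :: "'a::linorder set"
  assumes "finite S" "finite T"
    and sep: "\<And>x y. x \<in> S \<Longrightarrow> y \<in> S \<Longrightarrow> x < y \<Longrightarrow> \<exists>z\<in>T. x < z \<and> z < y"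
  shows "card S \<le> Suc (card T)"
proof (cases "S = {}")
  case False
  define nxt where "nxt x = Min {y\<in>S. x < y}" for x
  have nxt: "nxt x \<in> S \<and> x < nxt x \<and> (\<forall>y\<in>S. x < y \<longrightarrow> nxt x \<le> y)" if "x \<in> S - {Max S}" for x
  proof -
    have "x < Max S"
      using that assms(1) by (metis DiffD1 DiffD2 Max_ge insertI1 order_less_le)
    then have ne: "{y\<in>S. x < y} \<noteq> {}"
      using Max_in[OF assms(1) False] by blast
    have "nxt x \<in> {y\<in>S. x < y}"
      unfolding nxt_def using assms(1) ne by (intro Min_in) auto
    then show ?thesis
      using assms(1) by (auto simp: nxt_def)
  qed
  have "\<forall>x\<in>S - {Max S}. \<exists>z\<in>T. x < z \<and> z < nxt x"
    using nxt sep by blast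
  then obtain g where g: "\<And>x. x \<in> S - {Max S} \<Longrightarrow> g x \<in> T \<and> x < g x \<and> g x < nxt x"
    by metis
  have "inj_on g (S - {Max S})"
  proof (rule linorder_inj_onI)
    fix x y assume "x < y" "x \<in> S - {Max S}" "y \<in> S - {Max S}"
    then have "g x < nxt x" "nxt x \<le> y" "y < g y"
      using g nxt by auto
    then show "g x \<noteq> g y" by auto
  qed auto
  then have "card (S - {Max S}) \<le> card T"
    using g assms(2) by (intro card_inj_on_le[of g]) auto
  then show ?thesis
    using assms(1) Max_in[OF assms(1) False] by (simp add: card_Diff_singleton)
qed simp

text \<open>Rolle's theorem: two positive roots of \<open>p\<close> are separated by a root of the
  derivative.\<close>

lemma card_pos_roots_le_pderiv:
  fixes p :: "real poly"
  assumes "pderiv p \<noteq> 0"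
  shows "card {x. 0 < x \<and> poly p x = 0} \<le> Suc (card {x. 0 < x \<and> poly (pderiv p) x = 0})"
proof (rule card_le_Suc_card_separating)
  have "p \<noteq> 0" using assms by auto
  then show "finite {x. 0 < x \<and> poly p x = 0}"
    by (rule finite_subset[rotated, OF poly_roots_finite]) auto
  show "finite {x. 0 < x \<and> poly (pderiv p) x = 0}"
    by (rule finite_subset[rotated, OF poly_roots_finite[OF assms]]) auto
next
  fix x y :: real
  assume "x \<in> {x. 0 < x \<and> poly p x = 0}" "y \<in> {x. 0 < x \<and> poly p x = 0}" "x < y"
  then show "\<exists>z\<in>{x. 0 < x \<and> poly (pderiv p) x = 0}. x < z \<and> z < y"
    using poly_MVT[of x y p] by fastforce
qed

text \<open>The weak form of Descartes' rule of signs.\<close>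

lemma card_pos_roots_less_card_coeffs:
  fixes p :: "real poly"
  assumes "p \<noteq> 0"
  shows "card {x. 0 < x \<and> poly p x = 0} < card {n. coeff p n \<noteq> 0}"
  using assms
proof (induction "degree p" arbitrary: p rule: less_induct)
  case less
  have fin: "finite {n. coeff q n \<noteq> 0}" for q :: "real poly"
    by (rule finite_subset[of _ "{..degree q}"]) (auto intro: le_degree)
  obtain c q where p: "p = pCons c q" by (cases p)
  show ?case
  proof (cases "pderiv p = 0")
    case True
    then obtain h where h: "p = [:h:]"
      by (metis degree_eq_zeroE pderiv_eq_0_iff)
    then have "h \<noteq> 0" using less.prems by auto
    then have "{x. 0 < x \<and> poly p x = 0} = {}" "0 \<in> {n. coeff p n \<noteq> 0}"
      using h by auto
    then show ?thesis
      using fin[of p] by (metis card.empty card_gt_0_iff empty_iff)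
  next
    case nz: False
    show ?thesis
    proof (cases "c = 0")
      case True
      have q: "q \<noteq> 0" using p True less.prems by auto
      \<comment> \<open>Here \<open>p\<close> is x times \<open>q\<close>: dividing by x shifts the
        exponents and keeps the positive roots, while the degree drops.\<close>
      have "{n. coeff p n \<noteq> 0} = Suc ` {n. coeff q n \<noteq> 0}"
        using p True by (auto simp: coeff_pCons image_iff split: nat.splits) (metis not0_implies_Suc gr0_conv_Suc)
      then have "card {n. coeff p n \<noteq> 0} = card {n. coeff q n \<noteq> 0}"
        by (simp add: card_image)
      moreover have "{x. 0 < x \<and> poly p x = 0} = {x. 0 < x \<and> poly q x = 0}"
        using p True by auto
      ultimately show ?thesis
        using less.hyps[of q] q p by simp
    next
      case False
      \<comment> \<open>Differentiation removes the nonzero constant term, so the derivative has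
        fewer nonzero coefficients; this pays for the one extra root that Rolle allows.\<close>
      have "Suc ` {n. coeff (pderiv p) n \<noteq> 0} \<subseteq> {n. coeff p n \<noteq> 0} - {0}"
        by (auto simp: coeff_pderiv)
      then have "card (Suc ` {n. coeff (pderiv p) n \<noteq> 0}) \<le> card ({n. coeff p n \<noteq> 0} - {0})"
        using fin by (intro card_mono) auto
      also have "\<dots> < card {n. coeff p n \<noteq> 0}"
        using fin False p by (intro card_Diff1_less) auto
      finally have "card {n. coeff (pderiv p) n \<noteq> 0} < card {n. coeff p n \<noteq> 0}"
        by (simp add: card_image)
      moreover have "degree (pderiv p) < degree p"
        using nz by (metis degree_pderiv diff_less gr0I pderiv_eq_0_iff zero_less_one)
      then have "card {x. 0 < x \<and> poly (pderiv p) x = 0} < card {n. coeff (pderiv p) n \<noteq> 0}"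
        using less.hyps nz by blast
      ultimately show ?thesis
        using card_pos_roots_le_pderiv[OF nz] by linarith
    qed
  qed
qed

section \<open>The recursion for \<open>E\<close> and its behaviour at 0 and 1\<close>

lemma poly_E: "poly (E d) q = (\<Sum>i\<le>d. (-1) ^ (i + 1) * real (d choose i) * q ^ 2 ^ (d - i))"
  by (simp add: E_def poly_sum poly_monom atLeast0AtMost)

lemma poly_E_0: "poly (E 0) q = - q"
  by (simp add: poly_E)

lemma poly_E_Suc: "poly (E (Suc d)) q = poly (E d) (q\<^sup>2) - poly (E d) q"
proof -
  let ?t = "\<lambda>i. (-1) ^ (i + 1) * real (d choose i) * q ^ 2 ^ (Suc d - i)"
  have "poly (E (Suc d)) q
      = - (q ^ 2 ^ Suc d)
        + (\<Sum>i\<le>d. (-1) ^ (Suc i + 1) * real (Suc d choose Suc i) * q ^ 2 ^ (d - i))"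
    unfolding poly_E by (subst sum.atMost_Suc_shift) simp
  also have "(\<Sum>i\<le>d. (-1) ^ (Suc i + 1) * real (Suc d choose Suc i) * q ^ 2 ^ (d - i))
      = (\<Sum>i\<le>d. ?t (Suc i)) - poly (E d) q"
    unfolding poly_E sum_subtractf[symmetric]
    by (rule sum.cong) (auto simp: algebra_simps)
  also have "- (q ^ 2 ^ Suc d) + ((\<Sum>i\<le>d. ?t (Suc i)) - poly (E d) q)
      = (\<Sum>i\<le>Suc d. ?t i) - poly (E d) q"
    by (subst sum.atMost_Suc_shift) simp
  \<comment> \<open>The last term carries \<open>d choose Suc d\<close>, which is 0.\<close>
  also have "(\<Sum>i\<le>Suc d. ?t i) = (\<Sum>i\<le>d. ?t i)"
    by simp
  also have "\<dots> = poly (E d) (q\<^sup>2)"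
    unfolding poly_E by (rule sum.cong) (auto simp: Suc_diff_le power_mult[symmetric])
  finally show ?thesis .
qed

lemma poly_E_at_0: "poly (E d) 0 = 0"
  by (induction d) (simp_all add: poly_E_0 poly_E_Suc)

lemma poly_E_at_1: "d \<ge> 1 \<Longrightarrow> poly (E d) 1 = 0"
  by (cases d) (simp_all add: poly_E_Suc)

lemma DERIV_E_Suc:
  "(poly (E (Suc d)) has_real_derivative
      2 * q * poly (pderiv (E d)) (q\<^sup>2) - poly (pderiv (E d)) q) (at q)"
proof -
  have "((\<lambda>q. poly (E d) (q\<^sup>2)) has_real_derivative poly (pderiv (E d)) (q\<^sup>2) * (2 * q)) (at q)"
    by (rule DERIV_chain2[OF poly_DERIV]) (auto intro!: derivative_eq_intros)
  from DERIV_diff[OF this poly_DERIV[of "E d" q]] show ?thesis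
    by (simp add: poly_E_Suc[abs_def] mult.commute)
qed

lemma poly_pderiv_E_Suc:
  "poly (pderiv (E (Suc d))) q = 2 * q * poly (pderiv (E d)) (q\<^sup>2) - poly (pderiv (E d)) q"
  using DERIV_unique[OF poly_DERIV DERIV_E_Suc] .

lemma poly_pderiv_E_0: "poly (pderiv (E 0)) q = - 1"
  by (simp add: E_def monom_altdef pderiv_minus pderiv_pCons)

text \<open>At 0 the factor \<open>2 * q\<close> kills the first term of the recursion, so each step
  flips the sign.\<close>

lemma poly_pderiv_E_at_0: "poly (pderiv (E d)) 0 = (-1) ^ (d + 1)"
  by (induction d) (simp_all add: poly_pderiv_E_0 poly_pderiv_E_Suc)

text \<open>At 1 the recursion reads 2a - a = a, so the value for \<open>E 0\<close>
  persists.\<close>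

lemma poly_pderiv_E_at_1: "poly (pderiv (E d)) 1 = - 1"
  by (induction d) (simp_all add: poly_pderiv_E_0 poly_pderiv_E_Suc)

lemma E_sign_near_0:
  assumes "0 < e"
  obtains u where "0 < u" "u < e" "0 < (-1) ^ (d + 1) * poly (E d) u"
proof -
  let ?p = "smult ((-1) ^ (d + 1)) (E d)"
  have "poly (pderiv ?p) 0 = 1"
    by (simp add: pderiv_smult pderiv_minus poly_pderiv_E_at_0 flip: power_mult_distrib)
  then obtain c where c: "c > 0" "\<And>h. 0 < h \<Longrightarrow> h < c \<Longrightarrow> poly ?p 0 < poly ?p (0 + h)"
    using DERIV_pos_inc_right[OF poly_DERIV[of ?p 0]] by auto
  have "0 < min c e / 2" "min c e / 2 < c" "min c e / 2 < e"
    using c(1) assms by auto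
  then show ?thesis
    using c(2)[of "min c e / 2"] by (intro that) (auto simp: poly_E_at_0)
qed

lemma E_sign_near_1:
  assumes "e < 1" "d \<ge> 1"
  obtains v where "e < v" "v < 1" "0 < poly (E d) v"
proof -
  obtain c where c: "c > 0" "\<And>h. 0 < h \<Longrightarrow> h < c \<Longrightarrow> poly (E d) 1 < poly (E d) (1 - h)"
    using DERIV_neg_dec_left[OF poly_DERIV[of "E d" 1]] by (auto simp: poly_pderiv_E_at_1)
  define h where "h = min c (1 - e) / 2"
  have "0 < h" "h < c" "h < 1 - e"
    using c(1) assms by (auto simp: h_def min_def)
  then show ?thesis
    using c(2)[of h] assms(2) by (intro that[of "1 - h"]) (auto simp: poly_E_at_1)
qed

text \<open>The only possible exponents are the \<open>d + 1\<close> powers of two up to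
  \<open>2 ^ d\<close>, so the coefficient bound applies.\<close>

lemma card_pos_roots_E: "card {x. 0 < x \<and> poly (E d) x = 0} \<le> d"
  and finite_pos_roots_E: "finite {x. 0 < x \<and> poly (E d) x = 0}"
proof -
  have nz: "E d \<noteq> 0"
    using poly_pderiv_E_at_1[of d] by auto
  have "{n. coeff (E d) n \<noteq> 0} \<subseteq> (\<lambda>i. 2 ^ (d - i)) ` {0..d}"
  proof
    fix n assume "n \<in> {n. coeff (E d) n \<noteq> 0}"
    then have "(\<Sum>i=0..d. coeff (monom ((-1) ^ (i + 1) * real (d choose i)) (2 ^ (d - i))) n) \<noteq> 0"
      by (simp add: E_def coeff_sum)
    then obtain i where "i \<in> {0..d}"
      "coeff (monom ((-1) ^ (i + 1) * real (d choose i)) (2 ^ (d - i))) n \<noteq> 0"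
      by (meson sum.neutral)
    then show "n \<in> (\<lambda>i. 2 ^ (d - i)) ` {0..d}"
      by (auto simp: coeff_monom split: if_splits)
  qed
  then have "card {n. coeff (E d) n \<noteq> 0} \<le> card {0..d}"
    by (rule surj_card_le[rotated]) simp
  then show "card {x. 0 < x \<and> poly (E d) x = 0} \<le> d"
    using card_pos_roots_less_card_coeffs[OF nz] by simp
  show "finite {x. 0 < x \<and> poly (E d) x = 0}"
    by (rule finite_subset[rotated, OF poly_roots_finite[OF nz]]) auto
qed

section \<open>Separated lists of roots\<close>

text \<open>The invariant of the induction. The inequality with the square puts
  \<open>sqrt (r i)\<close> (for \<open>0 < i\<close>) and \<open>(r (Suc i))\<^sup>2\<close> (for
  \<open>Suc i < d\<close>) inside the i-th gap. The sign condition also rules out further roots in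
  the gaps; its exponent makes the last gap positive.\<close>

definition separated_roots :: "nat \<Rightarrow> (nat \<Rightarrow> real) \<Rightarrow> bool" where
  "separated_roots d r \<longleftrightarrow>
     r 0 = 0 \<and> r d = 1 \<and> (\<forall>i\<le>d. poly (E d) (r i) = 0) \<and>
     (\<forall>i<d. r i < r (Suc i) \<and> r i < (r (Suc i))\<^sup>2) \<and>
     (\<forall>i<d. \<forall>x. r i < x \<and> x < r (Suc i) \<longrightarrow> 0 < (-1) ^ (d + i + 1) * poly (E d) x)"

lemma less_if_less_Suc:
  fixes r :: "nat \<Rightarrow> 'a::order"
  assumes "\<And>i. i < d \<Longrightarrow> r i < r (Suc i)" "i < j" "j \<le> d"
  shows "r i < r j"
  using assms(2,3)
proof (induction j)
  case (Suc j)
  then show ?case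
    using assms(1)[of j] by (cases "i = j") (auto intro: less_trans)
qed simp

lemma separated_roots_less:
  assumes "separated_roots d r" "i < j" "j \<le> d"
  shows "r i < r j"
  using less_if_less_Suc[of d r] assms by (auto simp: separated_roots_def)

lemma separated_roots_bounds:
  assumes "separated_roots d r"
  shows "i \<le> d \<Longrightarrow> 0 \<le> r i" "i \<le> d \<Longrightarrow> r i \<le> 1"
    "0 < i \<Longrightarrow> i \<le> d \<Longrightarrow> 0 < r i" "i < d \<Longrightarrow> r i < 1"
proof -
  have rd: "r 0 = 0" "r d = 1"
    using assms by (auto simp: separated_roots_def)
  show pos: "0 < r i" if "0 < i" "i \<le> d"
    using separated_roots_less[OF assms, of 0 i] that rd by simp
  show less: "r i < 1" if "i < d"
    using separated_roots_less[OF assms, of i d] that rd by simp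
  show "0 \<le> r i" if "i \<le> d"
    using pos that rd by (cases "i = 0") auto
  show "r i \<le> 1" if "i \<le> d"
    using less that rd by (cases "i = d") auto
qed

lemma ex_between_Suc:
  fixes r :: "nat \<Rightarrow> 'a::linorder"
  assumes "r 0 < x" "x \<le> r d"
  shows "\<exists>i<d. r i < x \<and> x \<le> r (Suc i)"
  using assms(2)
proof (induction d)
  case 0
  then show ?case using assms(1) by simp
next
  case (Suc d)
  then show ?case
    by (cases "x \<le> r d") (auto intro: less_SucI)
qed

text \<open>The half-open gaps cover (0,1], and the sign condition leaves only their right ends as
  roots.\<close>

lemma separated_roots_all:
  assumes "separated_roots d r"
  shows "{q \<in> {0..1}. poly (E d) q = 0} = r ` {0..d}"
proof
  show "r ` {0..d} \<subseteq> {q \<in> {0..1}. poly (E d) q = 0}"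
    using assms separated_roots_bounds[OF assms] by (auto simp: separated_roots_def)
  show "{q \<in> {0..1}. poly (E d) q = 0} \<subseteq> r ` {0..d}"
  proof
    fix q assume q: "q \<in> {q \<in> {0..1}. poly (E d) q = 0}"
    show "q \<in> r ` {0..d}"
    proof (cases "q = 0")
      case True
      then show ?thesis using assms by (auto simp: separated_roots_def image_iff)
    next
      case False
      then have "r 0 < q" "q \<le> r d"
        using q assms by (auto simp: separated_roots_def)
      then obtain i where i: "i < d" "r i < q" "q \<le> r (Suc i)"
        using ex_between_Suc by blast
      have "q = r (Suc i)"
        using assms q i unfolding separated_roots_def by force
      then show ?thesis using i by auto
    qed
  qed
qed

lemma separated_roots_inj:
  assumes "separated_roots d r"
  shows "inj_on r {0..d}"
proof (rule linorder_inj_onI)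
  fix i j assume "i < j" "i \<in> {0..d}" "j \<in> {0..d}"
  then show "r i \<noteq> r j" using separated_roots_less[OF assms, of i j] by simp
qed auto

lemma separated_roots_inner:
  assumes "separated_roots d r" "d \<ge> 1"
  shows "{q \<in> {0<..<1}. poly (E d) q = 0} = r ` {1..d - 1}"
proof -
  have "r ` {0, d} = {0, 1}"
    using assms(1) by (auto simp: separated_roots_def)
  moreover have "{q \<in> {0<..<1}. poly (E d) q = 0} = {q \<in> {0..1}. poly (E d) q = 0} - {0, 1}"
    by auto
  ultimately have "{q \<in> {0<..<1}. poly (E d) q = 0} = r ` {0..d} - r ` {0, d}"
    using separated_roots_all[OF assms(1)] by simp
  also have "\<dots> = r ` ({0..d} - {0, d})"
    using inj_on_image_set_diff[OF separated_roots_inj[OF assms(1)], of "{0..d}" "{0, d}"] by auto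
  also have "{0..d} - {0, d} = {1..d - 1}"
    using assms(2) by auto
  finally show ?thesis .
qed

text \<open>\<open>E 1\<close> is q(1 - q), and the embedding \<open>real\<close> lists its roots 0
  and 1.\<close>

lemma separated_roots_1: "separated_roots 1 real"
proof -
  have E: "poly (E (Suc 0)) q = q * (1 - q)" for q
    by (simp add: poly_E_Suc poly_E_0 power2_eq_square algebra_simps)
  have "poly (E 1) (real i) = 0" if "i \<le> 1" for i
    using that by (cases "i = 0") (auto simp: E le_Suc_eq)
  then show ?thesis
    by (auto simp: separated_roots_def E)
qed

section \<open>The induction step from \<open>E d\<close> to \<open>E (Suc d)\<close>\<close>

text \<open>Besides the sign change, \<open>r i \<le> u\<^sup>2\<close> is recorded so that the new
  roots are separated again, and \<open>v < 1\<close> so that the last of them stays below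
  1.\<close>

lemma E_Suc_sign_change:
  assumes r: "separated_roots d r" and i: "i < d"
  obtains u v where "0 < u" "r i \<le> u" "r i \<le> u\<^sup>2" "u < v" "v \<le> r (Suc i)" "v < 1"
    "0 < (-1) ^ (d + i) * poly (E (Suc d)) u" "0 < (-1) ^ (d + i + 1) * poly (E (Suc d)) v"
proof -
  have rd: "r 0 = 0" "r d = 1" "poly (E d) (r i) = 0" "poly (E d) (r (Suc i)) = 0"
    and gap: "r i < (r (Suc i))\<^sup>2"
    and sgn: "\<And>x. r i < x \<Longrightarrow> x < r (Suc i) \<Longrightarrow> 0 < (-1) ^ (d + i + 1) * poly (E d) x"
    using r i by (auto simp: separated_roots_def)
  have r0: "0 \<le> r i" "r i < 1" "0 < r (Suc i)" "r (Suc i) \<le> 1"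
    using separated_roots_bounds[OF r] i by auto
  have sq: "sqrt (r i) < r (Suc i)"
    using gap r0 by (intro real_less_lsqrt) auto
  have "\<exists>u. 0 < u \<and> r i \<le> u \<and> r i \<le> u\<^sup>2 \<and> u < r (Suc i) \<and>
      0 < (-1) ^ (d + i) * poly (E (Suc d)) u"
  proof (cases "i = 0")
    case True
    \<comment> \<open>In the first gap \<open>sqrt (r i)\<close> is 0, itself a root of
      \<open>E (Suc d)\<close>, so the derivative at 0 supplies the sign; \<open>Suc d + 1\<close>
      has the parity of \<open>d\<close>.\<close>
    obtain u where "0 < u" "u < r (Suc i)" "0 < (-1) ^ (Suc d + 1) * poly (E (Suc d)) u"
      using E_sign_near_0[OF r0(3)] .
    then show ?thesis using True rd by auto
  next
    case False
    then have pos: "0 < r i" using separated_roots_bounds(3)[OF r] i by auto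
    then have lt: "r i < sqrt (r i)"
      using r0 by (intro real_less_rsqrt) (simp add: power2_eq_square)
    then have "0 < (-1) ^ (d + i + 1) * poly (E d) (sqrt (r i))"
      using sgn sq by blast
    \<comment> \<open>The term \<open>poly (E d) (r i)\<close> of the recursion vanishes; the
      remaining minus sign lowers the exponent by one.\<close>
    then have "0 < (-1) ^ (d + i) * poly (E (Suc d)) (sqrt (r i))"
      using pos rd by (simp add: poly_E_Suc)
    then show ?thesis using pos lt sq by (intro exI[of _ "sqrt (r i)"]) auto
  qed
  then obtain u where u: "0 < u" "r i \<le> u" "r i \<le> u\<^sup>2" "u < r (Suc i)"
      "0 < (-1) ^ (d + i) * poly (E (Suc d)) u" by blast
  have "\<exists>v. u < v \<and> v \<le> r (Suc i) \<and> v < 1 \<and> 0 < (-1) ^ (d + i + 1) * poly (E (Suc d)) v"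
  proof (cases "Suc i = d")
    case True
    have "u < 1" using u(4) r0(4) by simp
    \<comment> \<open>In the last gap \<open>r (Suc i)\<close> is 1, again a root of
      \<open>E (Suc d)\<close>, so a point just left of 1 is taken; \<open>d + i + 1\<close> is then
      even.\<close>
    then obtain v where "u < v" "v < 1" "0 < poly (E (Suc d)) v"
      using E_sign_near_1[of u "Suc d"] by auto
    then show ?thesis using True rd by (auto intro!: exI[of _ v])
  next
    case False
    then have lt: "r (Suc i) < 1" using separated_roots_bounds(4)[OF r] i by simp
    then have "(r (Suc i))\<^sup>2 < r (Suc i)" using r0 by (simp add: power2_eq_square)
    then have "0 < (-1) ^ (d + i + 1) * poly (E d) ((r (Suc i))\<^sup>2)"
      using sgn gap by blast
    then show ?thesis using u lt rd by (intro exI[of _ "r (Suc i)"]) (simp add: poly_E_Suc)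
  qed
  then show ?thesis using u that by blast
qed

text \<open>By the intermediate value theorem, a change of sign would force a root between
  \<open>x\<close> and \<open>y\<close>.\<close>

lemma poly_same_sign_if_no_root:
  fixes p :: "real poly"
  assumes "\<And>z. a < z \<Longrightarrow> z < b \<Longrightarrow> poly p z \<noteq> 0"
    and "a < x" "x < b" "a < y" "y < b" "0 < poly p x"
  shows "0 < poly p y"
proof (rule ccontr)
  assume "\<not> 0 < poly p y"
  then have neg: "poly p y < 0" using assms by force
  consider "x < y" | "y < x" using neg assms(6) by fastforce
  then show False
  proof cases
    case 1
    then obtain z where "x < z" "z < y" "poly p z = 0"
      using poly_IVT_neg[OF _ assms(6) neg] by blast
    then show ?thesis using assms(1)[of z] assms(2-5) by auto
  next
    case 2
    then obtain z where "y < z" "z < x" "poly p z = 0"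
      using poly_IVT_pos[OF _ neg assms(6)] by blast
    then show ?thesis using assms(1)[of z] assms(2-5) by auto
  qed
qed

text \<open>The d sign changes give d roots, and 1 is another; together they exhaust the bound
  \<open>Suc d\<close> on positive roots. With no root left over, one sample point fixes the sign on
  each new gap. The two inequalities obtained for \<open>s\<close> are the interleaving.\<close>

lemma separated_roots_Suc:
  assumes r: "separated_roots d r" and d: "d \<ge> 1"
  obtains s where "separated_roots (Suc d) s" "\<And>i. i < d \<Longrightarrow> s (Suc i) < r (Suc i)"
    "\<And>i. i < d \<Longrightarrow> r i < s (Suc i)"
proof -
  have rd: "r 0 = 0" "r d = 1"
    using r by (auto simp: separated_roots_def)
  have "\<forall>i. \<exists>u v. i < d \<longrightarrow> 0 < u \<and> r i \<le> u \<and> r i \<le> u\<^sup>2 \<and> u < v \<and> v \<le> r (Suc i) \<and> v < 1 \<and>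
    0 < (-1) ^ (d + i) * poly (E (Suc d)) u \<and> 0 < (-1) ^ (d + i + 1) * poly (E (Suc d)) v"
    using E_Suc_sign_change[OF r] by metis
  then obtain u v where uv: "\<And>i. i < d \<Longrightarrow> 0 < u i \<and> r i \<le> u i \<and> r i \<le> (u i)\<^sup>2 \<and> u i < v i \<and>
      v i \<le> r (Suc i) \<and> v i < 1 \<and>
      0 < (-1) ^ (d + i) * poly (E (Suc d)) (u i) \<and> 0 < (-1) ^ (d + i + 1) * poly (E (Suc d)) (v i)"
    by metis
  have "\<forall>i. \<exists>z. i < d \<longrightarrow> u i < z \<and> z < v i \<and> poly (E (Suc d)) z = 0"
  proof (intro allI)
    fix i
    have "\<exists>z. u i < z \<and> z < v i \<and> poly (E (Suc d)) z = 0" if "i < d"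
    proof -
      have "poly (smult ((-1) ^ (d + i)) (E (Suc d))) (v i) < 0"
        "0 < poly (smult ((-1) ^ (d + i)) (E (Suc d))) (u i)"
        using uv[OF that] by auto
      then show ?thesis
        using poly_IVT_neg[of "u i" "v i" "smult ((-1) ^ (d + i)) (E (Suc d))"] uv[OF that] by auto
    qed
    then show "\<exists>z. i < d \<longrightarrow> u i < z \<and> z < v i \<and> poly (E (Suc d)) z = 0" by blast
  qed
  then obtain z where z: "\<And>i. i < d \<Longrightarrow> u i < z i \<and> z i < v i \<and> poly (E (Suc d)) (z i) = 0"
    by metis
  \<comment> \<open>The root \<open>z i\<close> from the i-th old gap gets index
    \<open>Suc i\<close>, since 0 is put in front; 1 is the last root and the default
    beyond.\<close>
  define s where "s i = (if i = 0 then 0 else if i \<le> d then z (i - 1) else 1)" for i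
  have s0: "s 0 = 0" "s (Suc d) = 1"
    by (auto simp: s_def)
  have s: "u i < s (Suc i)" "s (Suc i) < v i" if "i < d" for i
    using z[OF that] that by (auto simp: s_def)
  have root: "poly (E (Suc d)) (s i) = 0" if "i \<le> Suc d" for i
    using that z[of "i - 1"] by (auto simp: s_def poly_E_at_0 poly_E_at_1)
  have upper: "s i \<le> r i" if "i \<le> d" for i
  proof (cases i)
    case 0
    then show ?thesis using s0 rd by simp
  next
    case (Suc j)
    then show ?thesis using s(2)[of j] uv[of j] that by auto
  qed
  have step: "s i < s (Suc i) \<and> s i < (s (Suc i))\<^sup>2" if "i < Suc d" for i
  proof (cases "i = d")
    case True
    obtain j where "d = Suc j" using d by (cases d) auto
    then show ?thesis using True s(2)[of j] uv[of j] s0 by auto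
  next
    case False
    then have i: "i < d" using that by simp
    \<comment> \<open>Separation passes on through
      \<open>s i \<le> r i \<le> (u i)\<^sup>2 < (s (Suc i))\<^sup>2\<close>.\<close>
    have "s i \<le> r i" "r i \<le> u i" "r i \<le> (u i)\<^sup>2" "0 < u i" "u i < s (Suc i)"
      using upper[of i] i uv[OF i] s[OF i] by auto
    moreover from this have "(u i)\<^sup>2 < (s (Suc i))\<^sup>2"
      by (intro power_strict_mono) auto
    ultimately show ?thesis by linarith
  qed
  have less: "s i < s j" if "i < j" "j \<le> Suc d" for i j
    using less_if_less_Suc[of "Suc d" s] step that by blast
  have pos: "0 < s i" if "1 \<le> i" "i \<le> Suc d" for i
    using less[of 0 i] that s0 by simp
  have "inj_on s {1..Suc d}"
  proof (rule linorder_inj_onI)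
    fix i j assume "i < j" "i \<in> {1..Suc d}" "j \<in> {1..Suc d}"
    then show "s i \<noteq> s j" using less[of i j] by simp
  qed auto
  then have "card (s ` {1..Suc d}) = Suc d"
    by (simp add: card_image)
  \<comment> \<open>\<open>Suc d\<close> distinct positive roots meet the upper bound, so there are
    no others.\<close>
  then have all: "s ` {1..Suc d} = {x. 0 < x \<and> poly (E (Suc d)) x = 0}"
    using finite_pos_roots_E card_pos_roots_E[of "Suc d"] root pos
    by (intro card_seteq) auto
  have noroot: "poly (E (Suc d)) x \<noteq> 0" if i: "i < Suc d" and x: "s i < x" "x < s (Suc i)" for i x
  proof
    assume "poly (E (Suc d)) x = 0"
    moreover have "0 \<le> s i" using pos[of i] s0 i by (cases "i = 0") auto
    ultimately have "x \<in> s ` {1..Suc d}" using x all by auto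
    then obtain j where j: "x = s j" "j \<le> Suc d" by auto
    consider "j < i" | "j = i" | "j = Suc i" | "Suc i < j" by linarith
    then show False
      using less[of j i] less[of "Suc i" j] i x j by cases auto
  qed
  have sign: "0 < (-1) ^ (Suc d + i + 1) * poly (E (Suc d)) x"
    if i: "i < Suc d" and x: "s i < x" "x < s (Suc i)" for i x
  proof -
    let ?p = "smult ((-1) ^ (Suc d + i + 1)) (E (Suc d))"
    \<comment> \<open>Sample points: \<open>u i\<close> lies in the i-th new gap for
      \<open>i < d\<close>, and \<open>v (d - 1)\<close> lies in the last one; the exponents agree
      modulo 2.\<close>
    have "\<exists>w. s i < w \<and> w < s (Suc i) \<and> 0 < poly ?p w"
    proof (cases "i = d")
      case True
      obtain j where j: "d = Suc j" using d by (cases d) auto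
      then show ?thesis using True s(2)[of j] uv[of j] s0 by (intro exI[of _ "v j"]) auto
    next
      case False
      then have i: "i < d" using i by simp
      have "s i < u i"
      proof (cases i)
        case 0
        then show ?thesis using s0 uv[OF i] by simp
      next
        case (Suc j)
        then show ?thesis using s(2)[of j] uv[of j] uv[OF i] i by simp
      qed
      then show ?thesis using s[OF i] uv[OF i] by (intro exI[of _ "u i"]) auto
    qed
    then obtain w where w: "s i < w" "w < s (Suc i)" "0 < poly ?p w" by blast
    have "0 < poly ?p x"
      using poly_same_sign_if_no_root[of "s i" "s (Suc i)" ?p w x] noroot[OF i] w x by simp
    then show ?thesis by simp
  qed
  have "separated_roots (Suc d) s"
    unfolding separated_roots_def using s0 root step sign by blast
  moreover have "s (Suc i) < r (Suc i)" "r i < s (Suc i)" if "i < d" for i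
    using s[OF that] uv[OF that] by auto
  ultimately show ?thesis using that by blast
qed

section \<open>Existence of the lists, uniqueness of enumerations, and the interleaving\<close>

lemma ex_separated_roots:
  assumes "d \<ge> 1"
  shows "\<exists>r. separated_roots d r"
  using assms
proof (induction d rule: dec_induct)
  case base
  then show ?case using separated_roots_1 by blast
next
  case (step d)
  then show ?case using separated_roots_Suc by metis
qed

text \<open>A strictly sorted list is determined by its set of elements. This identifies arbitrary
  increasing enumerations of the roots with the constructed ones.\<close>

lemma strict_mono_on_enum_unique:
  fixes a b :: "nat \<Rightarrow> 'a::linorder"
  assumes "strict_mono_on {1..n} a" "strict_mono_on {1..n} b" "a ` {1..n} = b ` {1..n}"
    and "i \<in> {1..n}"
  shows "a i = b i"
proof -
  have sorted: "sorted_wrt (<) (map f [1..<Suc n])" if "strict_mono_on {1..n} f"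
    for f :: "nat \<Rightarrow> 'a"
    using that by (auto simp: sorted_wrt_iff_nth_less strict_mono_on_def simp del: upt_Suc)
  have "set (map a [1..<Suc n]) = set (map b [1..<Suc n])"
    using assms(3) by (simp add: atLeastLessThanSuc_atLeastAtMost del: upt_Suc)
  then have "map a [1..<Suc n] = map b [1..<Suc n]"
    using strict_sorted_equal[OF sorted[OF assms(2)] sorted[OF assms(1)]] by simp
  then show ?thesis
    using assms(4) by (simp add: atLeastLessThanSuc_atLeastAtMost del: upt_Suc)
qed

lemma separated_roots_enum:
  assumes "separated_roots d r" "d \<ge> 1" "strict_mono_on {1..d - 1} a"
    "a ` {1..d - 1} = {q \<in> {0<..<1}. poly (E d) q = 0}" "i \<in> {1..d - 1}"
  shows "a i = r i"
proof (rule strict_mono_on_enum_unique[OF assms(3) _ _ assms(5)])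
  show "strict_mono_on {1..d - 1} r"
    using separated_roots_less[OF assms(1)] by (auto intro!: strict_mono_onI)
  show "a ` {1..d - 1} = r ` {1..d - 1}"
    using separated_roots_inner assms by simp
qed

theorem theorem7:
  fixes d :: nat
  assumes "d \<ge> 1"
  shows "card {q \<in> {0..1}. poly (E d) q = 0} = d + 1
    \<and> poly (E d) 0 = 0 \<and> poly (E d) 1 = 0
    \<and> (\<forall>a b :: nat \<Rightarrow> real.
        strict_mono_on {1..d - 1} a
        \<and> a ` {1..d - 1} = {q \<in> {0<..<1}. poly (E d) q = 0}
        \<and> strict_mono_on {1..d} b
        \<and> b ` {1..d} = {q \<in> {0<..<1}. poly (E (d + 1)) q = 0}
        \<longrightarrow> (\<forall>i \<in> {1..d - 1}. b i < a i \<and> a i < b (i + 1)))"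
proof -
  obtain r where r: "separated_roots d r"
    using ex_separated_roots[OF assms] by blast
  obtain s where s: "separated_roots (Suc d) s" "\<And>i. i < d \<Longrightarrow> s (Suc i) < r (Suc i)"
    "\<And>i. i < d \<Longrightarrow> r i < s (Suc i)"
    using separated_roots_Suc[OF r assms] by blast
  have "card {q \<in> {0..1}. poly (E d) q = 0} = d + 1"
    unfolding separated_roots_all[OF r] using separated_roots_inj[OF r] by (simp add: card_image)
  moreover have "b i < a i \<and> a i < b (i + 1)"
    if a: "strict_mono_on {1..d - 1} a" "a ` {1..d - 1} = {q \<in> {0<..<1}. poly (E d) q = 0}"
      and b: "strict_mono_on {1..d} b" "b ` {1..d} = {q \<in> {0<..<1}. poly (E (d + 1)) q = 0}"
      and i: "i \<in> {1..d - 1}" for a b :: "nat \<Rightarrow> real" and i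
  proof -
    have "a i = r i"
      using separated_roots_enum[OF r assms a i] .
    moreover have "b j = s j" if "j \<in> {1..d}" for j
      using separated_roots_enum[OF s(1), of b j] b that by simp
    \<comment> \<open>The first inequality is the interleaving at index \<open>i - 1\<close>, the
      second at index \<open>i\<close>.\<close>
    moreover have "s i < r i" "r i < s (Suc i)"
      using s(2)[of "i - 1"] s(3)[of i] i by auto
    ultimately show ?thesis using i by auto
  qed
  ultimately show ?thesis
    using poly_E_at_0 poly_E_at_1[OF assms] by blast
qed

end
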